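(* Let $\mathcal A$ be the collection of observed pairs in the HodgeRank framework. In the particular case where $\mathcal A=\{\{a,b\}\subset[n]\}$ (all pairs), the space of edge flows in the HodgeRank framework is equal to $H^2$, the space of gradient flows is equal to $H^2_1$, the space of curl flows is equal to $H^2_2$, and the space of harmonic flows is null. The Hodge decomposition then boils down to $H^2=H^2_1\oplus H^2_2$. There is no particular connection in the general case (that is, for a general collection $\mathcal A$ of pairs).
   Context: Let $n\ge 1$, $[n]=\{1,\dots,n\}$. For distinct $a,b\in[n]$, $ab$ denotes the two-letter word (the ranking $a\succ b$), and $x_{a\succ b}=\delta_{ab}-\delta_{ba}$, a function on the set of two-letter words with distinct letters in $[n]$ ($\delta$ denotes Dirac functions); so $x_{b\succ a}=-x_{a\succ b}$. For a pair $\{a,b\}$, $H_{\{a,b\}}=\mathbb R x_{a\succ b}$, and $H^2=\bigoplus_{\{a,b\}\subset[n]}H_{\{a,b\}}$, with basis $(x_{a\succ b})_{1\le a<b\le n}$. Set $$H^2_1=\operatorname{span}\Big\{e_a:=\sum_{b\ne a}x_{a\succ b}\ :\ a\in[n]\Big\},\qquad H^2_2=\operatorname{span}\Big\{f_{(a,b)}:=\sum_{c\notin\{a,b\}}(x_{a\succ b}+x_{b\succ c}+x_{c\succ a})\ :\ \{a,b\}\subset[n]\Big\}.$$ HodgeRank framework: given a collection $\mathcal A$ of pairs of elements of $[n]$ (the pairs that are compared), consider the graph $G$ with vertex set $[n]$ and edge set $\mathcal A$. Edge flows are antisymmetric functions $X$ on oriented edges, $X_{i,j}=-X_{j,i}$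 for $\{i,j\}\in\mathcal A$, with inner product $\sum_{i<j,\{i,j\}\in\mathcal A}X_{i,j}Y_{i,j}$; an edge flow $X$ is identified with the function $ij\mapsto X_{i,j}$, i.e. with $\sum_{i<j,\{i,j\}\in\mathcal A}X_{i,j}x_{i\succ j}\in\bigoplus_{\{a,b\}\in\mathcal A}H_{\{a,b\}}$. The gradient maps $s\in\mathbb R^n$ to the edge flow $\sum_{i<j,\{i,j\}\in\mathcal A}(s_i-s_j)x_{i\succ j}$. The curl maps an edge flow $X$ to the alternating function $(i,j,k)\mapsto X_{i,j}+X_{j,k}+X_{k,i}$ on the triangles of $G$, and $\mathrm{curl}^*$ is its adjoint. Gradient flows are the elements of $\operatorname{Im}(\mathrm{grad})$, curl flows those of $\operatorname{Im}(\mathrm{curl}^* )$, harmonic flows those orthogonal to both; the Hodge decomposition is the orthogonal decomposition of the space of edge flows into these three subspaces. *)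

theory Defs
  imports "HOL-Analysis.Analysis" "HOL-Analysis.Finite_Function_Topology"
begin

text \<open>
  The set \<open>[n]\<close> is \<open>{1..n}\<close>. A real function on two-letter words is a finitely supported function
  on \<open>nat \<times> nat\<close>, which makes the library's \<open>span\<close> available; the Dirac function at the word
  \<open>ab\<close> is \<open>Poly_Mapping.single (a, b) 1\<close>.
\<close>

type_synonym word_fun = "(nat \<times> nat, real) poly_mapping"

definition all_pairs :: "nat \<Rightarrow> nat set set" where
  "all_pairs n = {{a, b} | a b. a \<in> {1..n} \<and> b \<in> {1..n} \<and> a \<noteq> b}"

definition x_pref :: "nat \<Rightarrow> nat \<Rightarrow> word_fun" where
  "x_pref a b = Poly_Mapping.single (a, b) 1 - Poly_Mapping.single (b, a) 1"

definition H_pair :: "nat set \<Rightarrow> word_fun set" where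
  "H_pair p = {r *\<^sub>R x_pref a b | r a b. a \<noteq> b \<and> {a, b} = p}"

text \<open>
  The sum of the lines \<open>H_pair p\<close>; it is direct because distinct pairs give functions with
  disjoint supports.
\<close>

definition H2 :: "nat \<Rightarrow> word_fun set" where
  "H2 n = span (\<Union>p\<in>all_pairs n. H_pair p)"

definition H2_1 :: "nat \<Rightarrow> word_fun set" where
  "H2_1 n = span {\<Sum>b\<in>{1..n} - {a}. x_pref a b | a. a \<in> {1..n}}"

text \<open>
  Both orders of each pair are used below; exchanging \<open>a\<close> and \<open>b\<close> only changes the sign of the
  generator.
\<close>

definition H2_2 :: "nat \<Rightarrow> word_fun set" where
  "H2_2 n = span {\<Sum>c\<in>{1..n} - {a, b}. x_pref a b + x_pref b c + x_pref c a
                  | a b. a \<in> {1..n} \<and> b \<in> {1..n} \<and> a \<noteq> b}"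

text \<open>
  In the rest of the theory the edge set \<open>A\<close> is meant to satisfy \<open>A \<subseteq> all_pairs n\<close> for some \<open>n\<close>;
  in particular it is finite and contains no singletons. An edge flow is extended by \<open>0\<close> outside
  the oriented edges.
\<close>

definition edge_flows :: "nat set set \<Rightarrow> word_fun set" where
  "edge_flows A =
     {X. (\<forall>i j. {i, j} \<in> A \<longrightarrow> Poly_Mapping.lookup X (i, j) = - Poly_Mapping.lookup X (j, i)) \<and>
         (\<forall>i j. {i, j} \<notin> A \<longrightarrow> Poly_Mapping.lookup X (i, j) = 0)}"

definition ordered_edges :: "nat set set \<Rightarrow> (nat \<times> nat) set" where
  "ordered_edges A = {(i, j). i < j \<and> {i, j} \<in> A}"

definition edge_inner :: "nat set set \<Rightarrow> word_fun \<Rightarrow> word_fun \<Rightarrow> real" where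
  "edge_inner A X Y =
     (\<Sum>e\<in>ordered_edges A. Poly_Mapping.lookup X e * Poly_Mapping.lookup Y e)"

text \<open>
  An element of \<open>\<real>\<^sup>n\<close> is given by a function \<open>s\<close> on \<open>nat\<close>; its values outside \<open>{1..n}\<close> are
  irrelevant.
\<close>

definition grad :: "nat set set \<Rightarrow> (nat \<Rightarrow> real) \<Rightarrow> word_fun" where
  "grad A s = (\<Sum>(i, j)\<in>ordered_edges A. (s i - s j) *\<^sub>R x_pref i j)"

definition gradient_flows :: "nat set set \<Rightarrow> word_fun set" where
  "gradient_flows A = range (grad A)"

definition triangle :: "nat set set \<Rightarrow> nat \<Rightarrow> nat \<Rightarrow> nat \<Rightarrow> bool" where
  "triangle A i j k \<longleftrightarrow> {i, j} \<in> A \<and> {j, k} \<in> A \<and> {k, i} \<in> A"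

definition triangle_flows :: "nat set set \<Rightarrow> (nat \<Rightarrow> nat \<Rightarrow> nat \<Rightarrow> real) set" where
  "triangle_flows A =
     {\<Phi>. (\<forall>i j k. triangle A i j k \<longrightarrow> \<Phi> i j k = - \<Phi> j i k \<and> \<Phi> i j k = - \<Phi> i k j) \<and>
         (\<forall>i j k. \<not> triangle A i j k \<longrightarrow> \<Phi> i j k = 0)}"

definition triangle_inner ::
    "nat set set \<Rightarrow> (nat \<Rightarrow> nat \<Rightarrow> nat \<Rightarrow> real) \<Rightarrow> (nat \<Rightarrow> nat \<Rightarrow> nat \<Rightarrow> real) \<Rightarrow> real" where
  "triangle_inner A \<Phi> \<Psi> =
     (\<Sum>(i, j, k)\<in>{(i, j, k). i < j \<and> j < k \<and> triangle A i j k}. \<Phi> i j k * \<Psi> i j k)"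

definition curl :: "nat set set \<Rightarrow> word_fun \<Rightarrow> nat \<Rightarrow> nat \<Rightarrow> nat \<Rightarrow> real" where
  "curl A X i j k =
     (if triangle A i j k
      then Poly_Mapping.lookup X (i, j) + Poly_Mapping.lookup X (j, k) + Poly_Mapping.lookup X (k, i)
      else 0)"

text \<open>
  The library's \<open>adjoint\<close> is for linear maps between whole types, while \<open>curl A\<close> is a map between
  the inner product spaces \<open>edge_flows A\<close> and \<open>triangle_flows A\<close>. The description is proper because
  \<open>edge_inner A\<close> is positive definite on the finite-dimensional space \<open>edge_flows A\<close>.
\<close>

definition curl_adjoint :: "nat set set \<Rightarrow> (nat \<Rightarrow> nat \<Rightarrow> nat \<Rightarrow> real) \<Rightarrow> word_fun" where
  "curl_adjoint A \<Phi> =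
     (THE Y. Y \<in> edge_flows A \<and>
             (\<forall>X\<in>edge_flows A. edge_inner A X Y = triangle_inner A (curl A X) \<Phi>))"

definition curl_flows :: "nat set set \<Rightarrow> word_fun set" where
  "curl_flows A = curl_adjoint A ` triangle_flows A"

definition harmonic_flows :: "nat set set \<Rightarrow> word_fun set" where
  "harmonic_flows A =
     {X \<in> edge_flows A. (\<forall>Y\<in>gradient_flows A. edge_inner A X Y = 0) \<and>
                        (\<forall>Y\<in>curl_flows A. edge_inner A X Y = 0)}"

definition orthogonal_direct_sum ::
    "nat set set \<Rightarrow> word_fun set \<Rightarrow> word_fun set \<Rightarrow> word_fun set \<Rightarrow> bool" where
  "orthogonal_direct_sum A V U W \<longleftrightarrow>
     subspace U \<and> subspace W \<and> V = {u + w | u w. u \<in> U \<and> w \<in> W} \<and> U \<inter> W = {0} \<and>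
     (\<forall>u\<in>U. \<forall>w\<in>W. edge_inner A u w = 0)"

end

theory Submission
  imports Defs
begin

text \<open>
  Everything rests on two spanning statements and one identity.

  For every edge set \<open>A\<close> on finitely many vertices, the adjoint of the curl is explicit: it sends
  an alternating triangle function \<open>\<Phi>\<close> to the sum over triangles \<open>i < j < k\<close> of \<open>\<Phi> i j k\<close> times the
  circulation \<open>x_pref i j + x_pref j k + x_pref k i\<close>, because pairing an edge flow with that
  circulation computes its curl at \<open>(i, j, k)\<close>. So the curl flows are the span of the circulations
  around the triangles of \<open>A\<close> (\<open>curl_flows_eq_span\<close>), and gradients, having no curl, are orthogonal
  to them (\<open>gradient_orthogonal_curl\<close>). Likewise the gradients are spanned by the gradients of
  indicator functions of vertices.

  On the complete graph the gradient of the indicator of \<open>a\<close> is the generator \<open>e\<^sub>a\<close> of \<open>H2_1\<close>, and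
  the generators \<open>f\<^sub>a\<^sub>b\<close> of \<open>H2_2\<close> satisfy \<open>f\<^sub>a\<^sub>b = n x\<^sub>a\<^sub>b - e\<^sub>a + e\<^sub>b\<close> (\<open>triangle_sum_eq\<close>).
  Summing this identity around a triangle cancels the \<open>e\<close> terms and shows that \<open>n\<close> times a
  circulation is in \<open>H2_2\<close>; so the \<open>f\<^sub>a\<^sub>b\<close> span exactly the curl flows. Solving it for \<open>x\<^sub>a\<^sub>b\<close>
  shows \<open>H2 = H2_1 + H2_2\<close>, so no harmonic flow other than \<open>0\<close> is left.

  When a pair \<open>{a, b}\<close> is missing from \<open>A\<close>, all flows on \<open>A\<close> vanish at \<open>(a, b)\<close>, whereas
  \<open>x\<^sub>a\<^sub>b\<close>, \<open>e\<^sub>a\<close> and (for \<open>n \<ge> 3\<close>) \<open>f\<^sub>a\<^sub>b\<close> do not. If in addition \<open>A\<close> is not empty, some vertex has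
  both a neighbour and a non-neighbour in \<open>A\<close>; the gradient over \<open>A\<close> of its indicator function has
  a nonzero sum around the triangle which these three vertices form in the complete graph, so it is
  not in \<open>H2_1\<close>. Finally the 4-cycle has no triangle, and the circulation around it is harmonic
  there although it is the sum of two triangle circulations of the complete graph.
\<close>

section \<open>Two-letter words and edge flows\<close>

lemma lookup_scaleR:
  "Poly_Mapping.lookup (r *\<^sub>R (X :: ('a, 'b::real_vector) poly_mapping)) k
    = r *\<^sub>R Poly_Mapping.lookup X k"
proof -
  have "finite {k. r *\<^sub>R Poly_Mapping.lookup X k \<noteq> 0}"
    by (rule finite_subset[OF _ finite_lookup[of X]]) auto
  then show ?thesis
    by (simp add: scaleR_poly_mapping_def)
qed

lemma lookup_single_if:
  "Poly_Mapping.lookup (Poly_Mapping.single p (1::real)) q = (if q = p then 1 else 0)"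
  by (cases "q = p") (simp_all add: lookup_single_not_eq)

lemma lookup_x_pref:
  "Poly_Mapping.lookup (x_pref a b) (i, j) =
    (if i = a \<and> j = b then 1 else 0) - (if i = b \<and> j = a then 1 else 0)"
  unfolding x_pref_def lookup_minus lookup_single_if prod.inject ..

lemma x_pref_same [simp]: "x_pref a a = 0"
  by (simp add: x_pref_def)

lemma x_pref_swap: "x_pref b a = - x_pref a b"
  by (simp add: x_pref_def)

lemma mem_all_pairs [simp]: "{i, j} \<in> all_pairs n \<longleftrightarrow> i \<in> {1..n} \<and> j \<in> {1..n} \<and> i \<noteq> j"
  unfolding all_pairs_def mem_Collect_eq doubleton_eq_iff by blast

lemma distinct_edge:
  assumes "A \<subseteq> all_pairs n" "{i, j} \<in> A"
  shows "i \<noteq> j"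
  using assms mem_all_pairs by blast

lemma finite_ordered_edges:
  assumes "A \<subseteq> all_pairs n"
  shows "finite (ordered_edges A)"
proof (rule finite_subset)
  show "ordered_edges A \<subseteq> {1..n} \<times> {1..n}"
    using assms mem_all_pairs by (fastforce simp: ordered_edges_def)
qed simp

lemma subspace_edge_flows: "subspace (edge_flows A)"
  by (auto simp: subspace_def edge_flows_def lookup_add lookup_scaleR algebra_simps)

lemma x_pref_edge_flow:
  assumes "{a, b} \<in> A"
  shows "x_pref a b \<in> edge_flows A"
proof -
  have "{b, a} \<in> A" using assms by (simp add: insert_commute)
  then have off: "\<not> (i = a \<and> j = b)" "\<not> (i = b \<and> j = a)" if "{i, j} \<notin> A" for i j
    using that assms by blast+
  have "Poly_Mapping.lookup (x_pref a b) (i, j) = - Poly_Mapping.lookup (x_pref a b) (j, i)" for i j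
    unfolding lookup_x_pref by (simp add: conj_commute)
  moreover have "Poly_Mapping.lookup (x_pref a b) (i, j) = 0" if "{i, j} \<notin> A" for i j
    unfolding lookup_x_pref if_not_P[OF off(1)[OF that]] if_not_P[OF off(2)[OF that]]
    by (rule diff_self)
  ultimately show ?thesis
    unfolding edge_flows_def by blast
qed

lemma lookup_sum_x_pref:
  assumes "A \<subseteq> all_pairs n"
  shows "Poly_Mapping.lookup (\<Sum>(i, j)\<in>ordered_edges A. g i j *\<^sub>R x_pref i j) (a, b) =
    (if (a, b) \<in> ordered_edges A then g a b else 0) -
    (if (b, a) \<in> ordered_edges A then g b a else 0)"
proof -
  have "Poly_Mapping.lookup (\<Sum>(i, j)\<in>ordered_edges A. g i j *\<^sub>R x_pref i j) (a, b) =
      (\<Sum>e\<in>ordered_edges A. (if e = (a, b) then g a b else 0) - (if e = (b, a) then g b a else 0))"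
    unfolding lookup_sum
  proof (rule sum.cong[OF refl], clarify)
    fix i j
    show "Poly_Mapping.lookup (g i j *\<^sub>R x_pref i j) (a, b) =
        (if (i, j) = (a, b) then g a b else 0) - (if (i, j) = (b, a) then g b a else 0)"
      by (cases "i = a"; cases "j = b"; cases "i = b"; cases "j = a")
        (simp_all add: lookup_scaleR lookup_x_pref)
  qed
  then show ?thesis
    by (simp add: sum_subtractf finite_ordered_edges[OF assms])
qed

lemma edge_flow_expansion:
  assumes A: "A \<subseteq> all_pairs n" and X: "X \<in> edge_flows A"
  shows "X = (\<Sum>(i, j)\<in>ordered_edges A. Poly_Mapping.lookup X (i, j) *\<^sub>R x_pref i j)"
proof (rule poly_mapping_eqI, clarify)
  fix a b
  have "Poly_Mapping.lookup X (a, b) = - Poly_Mapping.lookup X (b, a)" if "{a, b} \<in> A"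
    using X that unfolding edge_flows_def by blast
  moreover have "Poly_Mapping.lookup X (a, b) = 0" if "{a, b} \<notin> A"
    using X that unfolding edge_flows_def by blast
  moreover have "{a, b} \<in> A \<longleftrightarrow> {b, a} \<in> A"
    by (simp add: insert_commute)
  ultimately show "Poly_Mapping.lookup X (a, b) = Poly_Mapping.lookup
      (\<Sum>(i, j)\<in>ordered_edges A. Poly_Mapping.lookup X (i, j) *\<^sub>R x_pref i j) (a, b)"
    using distinct_edge[OF A, of a b] unfolding lookup_sum_x_pref[OF A]
    by (cases "{a, b} \<in> A"; cases a b rule: linorder_cases) (simp_all add: ordered_edges_def)
qed

lemma H2_eq_span: "H2 n = span {x_pref a b | a b. {a, b} \<in> all_pairs n}"
  unfolding H2_def
proof (rule span_eq[THEN iffD2], intro conjI subsetI)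
  fix X assume "X \<in> (\<Union>p\<in>all_pairs n. H_pair p)"
  then obtain r a b where "X = r *\<^sub>R x_pref a b" "{a, b} \<in> all_pairs n"
    by (auto simp: H_pair_def)
  then show "X \<in> span {x_pref a b | a b. {a, b} \<in> all_pairs n}"
    by (metis (mono_tags, lifting) mem_Collect_eq span_base span_scale)
next
  fix X assume "X \<in> {x_pref a b | a b. {a, b} \<in> all_pairs n}"
  then obtain a b where ab: "X = x_pref a b" "{a, b} \<in> all_pairs n"
    by blast
  then have "X = 1 *\<^sub>R x_pref a b" "a \<noteq> b" by simp_all
  then have "X \<in> H_pair {a, b}" unfolding H_pair_def by blast
  with ab show "X \<in> span (\<Union>p\<in>all_pairs n. H_pair p)"
    by (blast intro: span_base)
qed

lemma edge_flows_complete: "edge_flows (all_pairs n) = H2 n"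
proof
  show "edge_flows (all_pairs n) \<subseteq> H2 n"
  proof
    fix X assume "X \<in> edge_flows (all_pairs n)"
    then have "X = (\<Sum>(i, j)\<in>ordered_edges (all_pairs n). Poly_Mapping.lookup X (i, j) *\<^sub>R x_pref i j)"
      by (rule edge_flow_expansion[OF subset_refl])
    moreover have "\<dots> \<in> H2 n"
      unfolding H2_eq_span
      by (rule span_sum, clarify, rule span_scale, rule span_base) (auto simp: ordered_edges_def)
    ultimately show "X \<in> H2 n" by simp
  qed
  show "H2 n \<subseteq> edge_flows (all_pairs n)"
    unfolding H2_eq_span
    by (rule span_minimal[OF _ subspace_edge_flows]) (auto intro!: x_pref_edge_flow)
qed

section \<open>The inner product on edge flows\<close>

lemma edge_inner_commute: "edge_inner A X Y = edge_inner A Y X"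
  by (simp add: edge_inner_def mult.commute)

lemma linear_edge_inner: "linear (edge_inner A X)"
  by (rule linearI) (simp_all add: edge_inner_def lookup_add lookup_scaleR algebra_simps
      sum.distrib sum_distrib_left)

lemma edge_inner_self_eq_0:
  assumes A: "A \<subseteq> all_pairs n" and X: "X \<in> edge_flows A" and 0: "edge_inner A X X = 0"
  shows "X = 0"
proof -
  have "\<forall>e\<in>ordered_edges A. Poly_Mapping.lookup X e = 0"
    using 0 by (simp add: edge_inner_def sum_nonneg_eq_0_iff finite_ordered_edges[OF A])
  then have "(\<Sum>(i, j)\<in>ordered_edges A. Poly_Mapping.lookup X (i, j) *\<^sub>R x_pref i j) = 0"
    by (intro sum.neutral) auto
  then show ?thesis
    using edge_flow_expansion[OF A X] by simp
qed

lemma edge_inner_x_pref: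
  assumes A: "A \<subseteq> all_pairs n" and X: "X \<in> edge_flows A" and ab: "{a, b} \<in> A"
  shows "edge_inner A X (x_pref a b) = Poly_Mapping.lookup X (a, b)"
proof -
  have less: "edge_inner A X (x_pref c d) = Poly_Mapping.lookup X (c, d)"
    if "c < d" "{c, d} \<in> A" for c d
  proof -
    have "edge_inner A X (x_pref c d) =
        (\<Sum>e\<in>ordered_edges A. if e = (c, d) then Poly_Mapping.lookup X (c, d) else 0)"
      unfolding edge_inner_def
    proof (rule sum.cong[OF refl], clarify)
      fix i j assume "(i, j) \<in> ordered_edges A"
      then have off: "\<not> (i = d \<and> j = c)"
        using \<open>c < d\<close> by (auto simp: ordered_edges_def)
      then show "Poly_Mapping.lookup X (i, j) * Poly_Mapping.lookup (x_pref c d) (i, j) =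
          (if (i, j) = (c, d) then Poly_Mapping.lookup X (c, d) else 0)"
        unfolding lookup_x_pref if_not_P[OF off] by simp
    qed
    then show ?thesis
      using that by (simp add: finite_ordered_edges[OF A]) (simp add: ordered_edges_def)
  qed
  have "{b, a} \<in> A" using ab by (simp add: insert_commute)
  consider "a < b" | "b < a"
    using distinct_edge[OF A ab] by linarith
  then show ?thesis
  proof cases
    case 2
    have "edge_inner A X (x_pref a b) = - edge_inner A X (x_pref b a)"
      unfolding x_pref_swap[of a b] by (rule linear_neg[OF linear_edge_inner])
    also have "\<dots> = - Poly_Mapping.lookup X (b, a)"
      using less 2 \<open>{b, a} \<in> A\<close> by simp
    also have "\<dots> = Poly_Mapping.lookup X (a, b)"
      using X ab unfolding edge_flows_def by simp
    finally show ?thesis .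
  qed (use less ab in blast)
qed

section \<open>Curl flows\<close>

definition circulation :: "nat \<Rightarrow> nat \<Rightarrow> nat \<Rightarrow> word_fun" where
  "circulation i j k = x_pref i j + x_pref j k + x_pref k i"

definition ordered_triangles :: "nat set set \<Rightarrow> (nat \<times> nat \<times> nat) set" where
  "ordered_triangles A = {(i, j, k). i < j \<and> j < k \<and> triangle A i j k}"

lemma circulation_rotate: "circulation j k i = circulation i j k"
  by (simp add: circulation_def)

lemma circulation_swap: "circulation j i k = - circulation i j k"
  by (simp add: circulation_def x_pref_swap[of i j] x_pref_swap[of i k] x_pref_swap[of j k])

lemma circulation_edge_flow:
  "triangle A i j k \<Longrightarrow> circulation i j k \<in> edge_flows A"
  unfolding circulation_def triangle_def
  by (intro subspace_add[OF subspace_edge_flows] x_pref_edge_flow) auto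

lemma edge_inner_circulation:
  assumes "A \<subseteq> all_pairs n" "X \<in> edge_flows A" "triangle A i j k"
  shows "edge_inner A X (circulation i j k) = curl A X i j k"
  using assms
  by (simp add: circulation_def curl_def triangle_def linear_add[OF linear_edge_inner]
      edge_inner_x_pref)

lemma finite_ordered_triangles:
  assumes "A \<subseteq> all_pairs n"
  shows "finite (ordered_triangles A)"
proof (rule finite_subset)
  show "ordered_triangles A \<subseteq> {1..n} \<times> {1..n} \<times> {1..n}"
    using assms mem_all_pairs by (fastforce simp: ordered_triangles_def triangle_def)
qed simp

text \<open>
  The right-hand side is an edge flow, and pairing an edge flow with a circulation evaluates the
  curl, so it has the defining property of the adjoint; two flows with that property differ by a
  flow orthogonal to itself.
\<close>

lemma curl_adjoint_eq:
  assumes A: "A \<subseteq> all_pairs n"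
  shows "curl_adjoint A \<Phi> = (\<Sum>(i, j, k)\<in>ordered_triangles A. \<Phi> i j k *\<^sub>R circulation i j k)"
    (is "_ = ?S")
  unfolding curl_adjoint_def
proof (rule the_equality, intro conjI ballI)
  show S: "?S \<in> edge_flows A"
    by (rule subspace_sum[OF subspace_edge_flows])
      (auto simp: ordered_triangles_def intro!: subspace_scale[OF subspace_edge_flows]
        circulation_edge_flow)
  show inner: "edge_inner A X ?S = triangle_inner A (curl A X) \<Phi>" if "X \<in> edge_flows A" for X
    unfolding linear_sum[OF linear_edge_inner] triangle_inner_def ordered_triangles_def[symmetric]
    using that by (intro sum.cong)
      (auto simp: linear_scale[OF linear_edge_inner] edge_inner_circulation[OF A]
        ordered_triangles_def)
  fix Y assume Y: "Y \<in> edge_flows A \<and>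
      (\<forall>X\<in>edge_flows A. edge_inner A X Y = triangle_inner A (curl A X) \<Phi>)"
  then have D: "Y - ?S \<in> edge_flows A"
    using S by (simp add: subspace_diff[OF subspace_edge_flows])
  then have "edge_inner A (Y - ?S) (Y - ?S) = 0"
    using Y inner by (simp add: linear_diff[OF linear_edge_inner])
  then show "Y = ?S"
    using edge_inner_self_eq_0[OF A D] by simp
qed

lemma subspace_curl_flows:
  assumes A: "A \<subseteq> all_pairs n"
  shows "subspace (curl_flows A)"
proof (rule subspaceI)
  have "curl_adjoint A (\<lambda>i j k. 0) = 0"
    by (simp add: curl_adjoint_eq[OF A])
  moreover have "(\<lambda>i j k. 0) \<in> triangle_flows A"
    by (simp add: triangle_flows_def)
  ultimately show "0 \<in> curl_flows A"
    unfolding curl_flows_def by (metis imageI)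
next
  fix X Y assume "X \<in> curl_flows A" "Y \<in> curl_flows A"
  then obtain \<Phi> \<Psi> where P: "\<Phi> \<in> triangle_flows A" "\<Psi> \<in> triangle_flows A"
      and XY: "X = curl_adjoint A \<Phi>" "Y = curl_adjoint A \<Psi>"
    by (auto simp: curl_flows_def)
  have "X + Y = curl_adjoint A (\<lambda>i j k. \<Phi> i j k + \<Psi> i j k)"
    by (simp add: XY curl_adjoint_eq[OF A] scaleR_add_left sum.distrib case_prod_unfold)
  moreover have "(\<lambda>i j k. \<Phi> i j k + \<Psi> i j k) \<in> triangle_flows A"
    using P unfolding triangle_flows_def by fastforce
  ultimately show "X + Y \<in> curl_flows A"
    by (simp add: curl_flows_def)
next
  fix r X assume "X \<in> curl_flows A"
  then obtain \<Phi> where P: "\<Phi> \<in> triangle_flows A" and X: "X = curl_adjoint A \<Phi>"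
    by (auto simp: curl_flows_def)
  have "r *\<^sub>R X = curl_adjoint A (\<lambda>i j k. r * \<Phi> i j k)"
    by (simp add: X curl_adjoint_eq[OF A] scaleR_sum_right case_prod_unfold)
  moreover have "(\<lambda>i j k. r * \<Phi> i j k) \<in> triangle_flows A"
    using P unfolding triangle_flows_def by fastforce
  ultimately show "r *\<^sub>R X \<in> curl_flows A"
    by (simp add: curl_flows_def)
qed

text \<open>The Dirac function at the oriented triangle \<open>(p, q, r)\<close>, made alternating.\<close>

definition alternating_dirac :: "nat \<Rightarrow> nat \<Rightarrow> nat \<Rightarrow> nat \<Rightarrow> nat \<Rightarrow> nat \<Rightarrow> real" where
  "alternating_dirac p q r i j k =
     of_bool (i = p \<and> j = q \<and> k = r) - of_bool (i = q \<and> j = p \<and> k = r)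
   + of_bool (i = q \<and> j = r \<and> k = p) - of_bool (i = p \<and> j = r \<and> k = q)
   + of_bool (i = r \<and> j = p \<and> k = q) - of_bool (i = r \<and> j = q \<and> k = p)"

lemma alternating_dirac_swap:
  "alternating_dirac p q r i j k = - alternating_dirac p q r j i k"
  "alternating_dirac p q r i j k = - alternating_dirac p q r i k j"
  by (simp_all add: alternating_dirac_def conj_ac)

lemma alternating_dirac_sorted:
  assumes "p < q" "q < r" "i < j" "j < k"
  shows "alternating_dirac p q r i j k = of_bool ((i, j, k) = (p, q, r))"
proof -
  have "\<not> (i = q \<and> j = p \<and> k = r)" "\<not> (i = q \<and> j = r \<and> k = p)" "\<not> (i = p \<and> j = r \<and> k = q)"
    "\<not> (i = r \<and> j = p \<and> k = q)" "\<not> (i = r \<and> j = q \<and> k = p)"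
    using assms by linarith+
  then show ?thesis
    unfolding alternating_dirac_def
    by (simp only: of_bool_eq prod.inject diff_0_right add_0_right)
qed

lemma alternating_dirac_triangle_flow:
  assumes "triangle A p q r"
  shows "alternating_dirac p q r \<in> triangle_flows A"
proof -
  have "alternating_dirac p q r i j k = 0" if "\<not> triangle A i j k" for i j k
  proof -
    have perm: "triangle A q p r" "triangle A q r p" "triangle A p r q" "triangle A r p q" "triangle A r q p"
      using assms by (simp_all add: triangle_def insert_commute)
    have "\<not> (i = p \<and> j = q \<and> k = r)" "\<not> (i = q \<and> j = p \<and> k = r)" "\<not> (i = q \<and> j = r \<and> k = p)"
      "\<not> (i = p \<and> j = r \<and> k = q)" "\<not> (i = r \<and> j = p \<and> k = q)" "\<not> (i = r \<and> j = q \<and> k = p)"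
      using that assms perm by blast+
    then show ?thesis
      unfolding alternating_dirac_def by (simp only: of_bool_eq diff_self add_0)
  qed
  then show ?thesis
    unfolding triangle_flows_def using alternating_dirac_swap by blast
qed

text \<open>
  The circulation around a triangle with increasing vertices is the adjoint of the curl at the
  alternating Dirac function of the triangle. Other vertex orders change the circulation at most
  by a sign.
\<close>

lemma circulation_curl_flow:
  assumes A: "A \<subseteq> all_pairs n" and tri: "triangle A p q r"
  shows "circulation p q r \<in> curl_flows A"
proof -
  have sorted: "circulation p q r \<in> curl_flows A" if "p < q" "q < r" "triangle A p q r" for p q r
  proof -
    have "curl_adjoint A (alternating_dirac p q r) =
        (\<Sum>t\<in>ordered_triangles A. if t = (p, q, r) then circulation p q r else 0)"
      unfolding curl_adjoint_eq[OF A]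
    proof (rule sum.cong[OF refl], clarify)
      fix i j k assume "(i, j, k) \<in> ordered_triangles A"
      then have "alternating_dirac p q r i j k = of_bool ((i, j, k) = (p, q, r))"
        using that by (intro alternating_dirac_sorted) (simp_all add: ordered_triangles_def)
      then show "alternating_dirac p q r i j k *\<^sub>R circulation i j k =
          (if (i, j, k) = (p, q, r) then circulation p q r else 0)"
        by simp
    qed
    also have "\<dots> = circulation p q r"
      using that by (simp add: finite_ordered_triangles[OF A]) (simp add: ordered_triangles_def)
    finally show ?thesis
      using alternating_dirac_triangle_flow[OF that(3)] unfolding curl_flows_def by (metis imageI)
  qed
  have rotate: "triangle A j k i" if "triangle A i j k" for i j k
    using that by (simp add: triangle_def)
  have swap: "triangle A j i k" if "triangle A i j k" for i j k
    using that by (simp add: triangle_def insert_commute)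
  have cyclic: "circulation p q r \<in> curl_flows A"
    if "triangle A p q r" "p < q \<and> q < r \<or> q < r \<and> r < p \<or> r < p \<and> p < q" for p q r
    using that sorted rotate circulation_rotate by metis
  consider "p < q \<and> q < r \<or> q < r \<and> r < p \<or> r < p \<and> p < q"
    | "q < p \<and> p < r \<or> p < r \<and> r < q \<or> r < q \<and> q < p"
    using tri distinct_edge[OF A] unfolding triangle_def by (metis linorder_neqE_nat)
  then show ?thesis
  proof cases
    case 1
    then show ?thesis using cyclic tri by blast
  next
    case 2
    then have "circulation q p r \<in> curl_flows A"
      using cyclic swap[OF tri] by blast
    then show ?thesis
      using subspace_neg[OF subspace_curl_flows[OF A]] circulation_swap by metis
  qed
qed

lemma curl_flows_eq_span:
  assumes A: "A \<subseteq> all_pairs n"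
  shows "curl_flows A = span {circulation i j k | i j k. triangle A i j k}"
proof
  show "curl_flows A \<subseteq> span {circulation i j k | i j k. triangle A i j k}"
  proof
    fix Y assume "Y \<in> curl_flows A"
    then obtain \<Phi> where "Y = (\<Sum>(i, j, k)\<in>ordered_triangles A. \<Phi> i j k *\<^sub>R circulation i j k)"
      by (auto simp: curl_flows_def curl_adjoint_eq[OF A])
    also have "\<dots> \<in> span {circulation i j k | i j k. triangle A i j k}"
      by (rule span_sum, clarify, rule span_scale, rule span_base)
        (auto simp: ordered_triangles_def)
    finally show "Y \<in> span {circulation i j k | i j k. triangle A i j k}" .
  qed
  show "span {circulation i j k | i j k. triangle A i j k} \<subseteq> curl_flows A"
    by (rule span_minimal[OF _ subspace_curl_flows[OF A]]) (auto intro: circulation_curl_flow[OF A])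
qed

lemma curl_flows_subset:
  assumes "A \<subseteq> all_pairs n"
  shows "curl_flows A \<subseteq> edge_flows A"
  unfolding curl_flows_eq_span[OF assms]
  by (rule span_minimal[OF _ subspace_edge_flows]) (auto intro: circulation_edge_flow)

section \<open>Gradient flows\<close>

lemma lookup_grad:
  assumes A: "A \<subseteq> all_pairs n"
  shows "Poly_Mapping.lookup (grad A s) (i, j) = (if {i, j} \<in> A then s i - s j else 0)"
  unfolding grad_def lookup_sum_x_pref[OF A] using distinct_edge[OF A, of i j]
  by (cases i j rule: linorder_cases) (auto simp: ordered_edges_def insert_commute)

lemma gradient_flows_subset:
  assumes A: "A \<subseteq> all_pairs n"
  shows "gradient_flows A \<subseteq> edge_flows A"
proof -
  have "grad A s \<in> edge_flows A" for s
    unfolding edge_flows_def by (auto simp: lookup_grad[OF A] insert_commute)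
  then show ?thesis by (auto simp: gradient_flows_def)
qed

lemma subspace_gradient_flows:
  assumes A: "A \<subseteq> all_pairs n"
  shows "subspace (gradient_flows A)"
  unfolding gradient_flows_def
proof (rule subspaceI)
  have "0 = grad A (\<lambda>i. 0)"
    by (simp add: grad_def)
  then show "0 \<in> range (grad A)" by blast
next
  fix X Y assume "X \<in> range (grad A)" "Y \<in> range (grad A)"
  then obtain s t where "X = grad A s" "Y = grad A t" by blast
  then have "X + Y = grad A (\<lambda>i. s i + t i)"
    by (auto intro!: poly_mapping_eqI simp: lookup_add lookup_grad[OF A])
  then show "X + Y \<in> range (grad A)" by blast
next
  fix r X assume "X \<in> range (grad A)"
  then obtain s where "X = grad A s" by blast
  then have "r *\<^sub>R X = grad A (\<lambda>i. r * s i)"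
    by (auto intro!: poly_mapping_eqI simp: lookup_scaleR lookup_grad[OF A] algebra_simps)
  then show "r *\<^sub>R X \<in> range (grad A)" by blast
qed

lemma grad_expansion:
  assumes A: "A \<subseteq> all_pairs n"
  shows "grad A s = (\<Sum>a\<in>{1..n}. s a *\<^sub>R grad A (\<lambda>i. of_bool (i = a)))"
proof (rule poly_mapping_eqI, clarify)
  fix i j
  show "Poly_Mapping.lookup (grad A s) (i, j) =
      Poly_Mapping.lookup (\<Sum>a\<in>{1..n}. s a *\<^sub>R grad A (\<lambda>i. of_bool (i = a))) (i, j)"
  proof (cases "{i, j} \<in> A")
    case True
    then have ij: "i \<in> {1..n}" "j \<in> {1..n}" using A mem_all_pairs by blast+
    have "(\<Sum>a\<in>{1..n}. s a * (of_bool (i = a) - of_bool (j = a))) =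
        (\<Sum>a\<in>{1..n}. (if a = i then s a else 0) - (if a = j then s a else 0))"
      by (intro sum.cong) auto
    also have "\<dots> = s i - s j" using ij by (simp add: sum_subtractf)
    finally show ?thesis
      using True by (simp add: lookup_sum lookup_scaleR lookup_grad[OF A])
  qed (simp add: lookup_sum lookup_scaleR lookup_grad[OF A])
qed

lemma curl_gradient:
  assumes "A \<subseteq> all_pairs n" "X \<in> gradient_flows A"
  shows "curl A X i j k = 0"
  using assms by (auto simp: gradient_flows_def curl_def triangle_def lookup_grad)

lemma gradient_orthogonal_curl:
  assumes A: "A \<subseteq> all_pairs n" and X: "X \<in> gradient_flows A" and Y: "Y \<in> curl_flows A"
  shows "edge_inner A X Y = 0"
proof -
  have "{circulation i j k | i j k. triangle A i j k} \<subseteq> {Y. edge_inner A X Y = 0}"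
    using edge_inner_circulation[OF A] curl_gradient[OF A X] gradient_flows_subset[OF A] X
    by (auto simp: subset_iff)
  moreover have "subspace {Y. edge_inner A X Y = 0}"
    by (rule linear_subspace_kernel[OF linear_edge_inner])
  ultimately show ?thesis
    using Y span_minimal unfolding curl_flows_eq_span[OF A] by blast
qed

section \<open>The complete graph\<close>

abbreviation star_flow :: "nat \<Rightarrow> nat \<Rightarrow> word_fun" where
  "star_flow n a \<equiv> \<Sum>b\<in>{1..n} - {a}. x_pref a b"

abbreviation triangle_sum :: "nat \<Rightarrow> nat \<Rightarrow> nat \<Rightarrow> word_fun" where
  "triangle_sum n a b \<equiv> \<Sum>c\<in>{1..n} - {a, b}. circulation a b c"

lemma star_flow_eq_grad:
  assumes "a \<in> {1..n}"
  shows "star_flow n a = grad (all_pairs n) (\<lambda>i. of_bool (i = a))"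
proof (rule poly_mapping_eqI, clarify)
  fix i j
  have "Poly_Mapping.lookup (star_flow n a) (i, j) =
     (\<Sum>b\<in>{1..n} - {a}. (if b = j then of_bool (i = a) else 0) - (if b = i then of_bool (j = a) else 0))"
    unfolding lookup_sum by (rule sum.cong) (auto simp: lookup_x_pref)
  also have "\<dots> = (if j \<in> {1..n} - {a} then of_bool (i = a) else 0) -
      (if i \<in> {1..n} - {a} then of_bool (j = a) else 0)"
    by (simp only: sum_subtractf sum.delta finite_Diff finite_atLeastAtMost)
  also have "\<dots> = Poly_Mapping.lookup (grad (all_pairs n) (\<lambda>i. of_bool (i = a))) (i, j)"
    using assms by (cases "i = a"; cases "j = a") (simp_all add: lookup_grad[OF subset_refl])
  finally show "Poly_Mapping.lookup (star_flow n a) (i, j) =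
      Poly_Mapping.lookup (grad (all_pairs n) (\<lambda>i. of_bool (i = a))) (i, j)" .
qed

lemma gradient_flows_complete: "gradient_flows (all_pairs n) = H2_1 n"
proof
  show "gradient_flows (all_pairs n) \<subseteq> H2_1 n"
  proof
    fix X assume "X \<in> gradient_flows (all_pairs n)"
    then obtain s where "X = grad (all_pairs n) s" by (auto simp: gradient_flows_def)
    also have "\<dots> = (\<Sum>a\<in>{1..n}. s a *\<^sub>R star_flow n a)"
      by (subst grad_expansion[OF subset_refl], rule sum.cong[OF refl])
        (simp only: star_flow_eq_grad)
    also have "\<dots> \<in> H2_1 n"
      unfolding H2_1_def by (intro span_sum span_scale span_base) blast
    finally show "X \<in> H2_1 n" .
  qed
  show "H2_1 n \<subseteq> gradient_flows (all_pairs n)"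
    unfolding H2_1_def
  proof (rule span_minimal[OF _ subspace_gradient_flows[OF subset_refl]], clarify)
    fix a assume "a \<in> {1..n}"
    then show "star_flow n a \<in> gradient_flows (all_pairs n)"
      unfolding gradient_flows_def by (simp only: star_flow_eq_grad rangeI)
  qed
qed

text \<open>
  The sum over \<open>c\<close> can run over all of \<open>{1..n}\<close>, because a circulation with a repeated vertex is
  \<open>0\<close>; then its first summand contributes \<open>n\<close> times, and the other two give the star flows.
\<close>

lemma triangle_sum_eq:
  assumes "a \<in> {1..n}" "b \<in> {1..n}"
  shows "triangle_sum n a b = real n *\<^sub>R x_pref a b - star_flow n a + star_flow n b"
proof -
  have star: "(\<Sum>c\<in>{1..n}. x_pref d c) = star_flow n d" for d
    by (rule sum.mono_neutral_right) auto
  have "triangle_sum n a b = (\<Sum>c\<in>{1..n}. circulation a b c)"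
    using assms
    by (intro sum.mono_neutral_left) (auto simp: circulation_def x_pref_swap[of a b])
  also have "\<dots> = (\<Sum>c\<in>{1..n}. x_pref a b + x_pref b c - x_pref a c)"
    by (simp add: circulation_def x_pref_swap[of a])
  also have "\<dots> = real n *\<^sub>R x_pref a b + star_flow n b - star_flow n a"
    by (simp only: sum.distrib sum_subtractf sum_constant_scaleR star card_atLeastAtMost) simp
  finally show ?thesis by simp
qed

lemma H2_2_eq_span:
  "H2_2 n = span {triangle_sum n a b | a b. a \<in> {1..n} \<and> b \<in> {1..n} \<and> a \<noteq> b}"
  unfolding H2_2_def circulation_def ..

lemma triangle_sum_in_H2_2:
  "a \<in> {1..n} \<Longrightarrow> b \<in> {1..n} \<Longrightarrow> a \<noteq> b \<Longrightarrow> triangle_sum n a b \<in> H2_2 n"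
  unfolding H2_2_eq_span by (rule span_base) blast

lemma triangle_complete:
  "triangle (all_pairs n) a b c \<longleftrightarrow>
    a \<in> {1..n} \<and> b \<in> {1..n} \<and> c \<in> {1..n} \<and> a \<noteq> b \<and> b \<noteq> c \<and> c \<noteq> a"
  by (auto simp: triangle_def)

lemma circulation_in_H2_2:
  assumes "triangle (all_pairs n) a b c"
  shows "circulation a b c \<in> H2_2 n"
proof -
  have abc: "a \<in> {1..n}" "b \<in> {1..n}" "c \<in> {1..n}" "a \<noteq> b" "b \<noteq> c" "c \<noteq> a"
    using assms by (simp_all add: triangle_complete)
  \<comment> \<open>The star flows telescope around the triangle.\<close>
  have "triangle_sum n a b + triangle_sum n b c + triangle_sum n c a = real n *\<^sub>R circulation a b c"
    by (simp only: triangle_sum_eq abc) (simp add: circulation_def scaleR_add_right)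
  moreover have "triangle_sum n a b + triangle_sum n b c + triangle_sum n c a \<in> H2_2 n"
    using triangle_sum_in_H2_2 abc unfolding H2_2_def by (metis (no_types, lifting) span_add)
  ultimately have "(1 / real n) *\<^sub>R real n *\<^sub>R circulation a b c \<in> H2_2 n"
    unfolding H2_2_def by (simp only: span_scale)
  moreover have "n \<noteq> 0" using abc by auto
  ultimately show ?thesis by simp
qed

lemma curl_flows_complete: "curl_flows (all_pairs n) = H2_2 n"
proof
  show "curl_flows (all_pairs n) \<subseteq> H2_2 n"
    unfolding curl_flows_eq_span[OF subset_refl]
  proof (rule span_minimal)
    show "{circulation i j k | i j k. triangle (all_pairs n) i j k} \<subseteq> H2_2 n"
      using circulation_in_H2_2 by blast
    show "subspace (H2_2 n)"
      by (simp only: H2_2_def subspace_span)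
  qed
  have "triangle_sum n a b \<in> curl_flows (all_pairs n)"
    if "a \<in> {1..n}" "b \<in> {1..n}" "a \<noteq> b" for a b
    by (rule subspace_sum[OF subspace_curl_flows[OF subset_refl]])
      (use that in \<open>auto intro!: circulation_curl_flow[OF subset_refl] simp: triangle_complete\<close>)
  then show "H2_2 n \<subseteq> curl_flows (all_pairs n)"
    unfolding H2_2_eq_span
    by (intro span_minimal subspace_curl_flows[OF subset_refl]) blast
qed

text \<open>
  The identity for \<open>triangle_sum n a b\<close>, solved for \<open>x_pref a b\<close>, splits the latter into a
  gradient and a curl flow.
\<close>

lemma H2_eq_sum:
  assumes "n \<ge> 1"
  shows "H2 n = {u + w | u w. u \<in> H2_1 n \<and> w \<in> H2_2 n}"
proof
  have sub: "subspace {u + w | u w. u \<in> H2_1 n \<and> w \<in> H2_2 n}"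
    by (rule subspace_sums) (simp_all add: H2_1_def H2_2_def)
  have "x_pref a b \<in> {u + w | u w. u \<in> H2_1 n \<and> w \<in> H2_2 n}" if "{a, b} \<in> all_pairs n" for a b
  proof -
    from that have ab: "a \<in> {1..n}" "b \<in> {1..n}" "a \<noteq> b" by simp_all
    have "star_flow n a - star_flow n b \<in> H2_1 n"
      unfolding H2_1_def using ab by (intro span_diff span_base) blast+
    then have "(1 / real n) *\<^sub>R (star_flow n a - star_flow n b) \<in> H2_1 n"
      unfolding H2_1_def by (rule span_scale)
    moreover have "(1 / real n) *\<^sub>R triangle_sum n a b \<in> H2_2 n"
      using triangle_sum_in_H2_2[OF ab] unfolding H2_2_def by (rule span_scale)
    moreover have "x_pref a b = (1 / real n) *\<^sub>R (star_flow n a - star_flow n b)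
        + (1 / real n) *\<^sub>R triangle_sum n a b"
      using assms by (simp only: triangle_sum_eq ab) (simp add: scaleR_right_diff_distrib scaleR_add_right)
    ultimately show ?thesis by blast
  qed
  then show "H2 n \<subseteq> {u + w | u w. u \<in> H2_1 n \<and> w \<in> H2_2 n}"
    unfolding H2_eq_span by (intro span_minimal sub) blast
  show "{u + w | u w. u \<in> H2_1 n \<and> w \<in> H2_2 n} \<subseteq> H2 n"
    using gradient_flows_subset[OF subset_refl, of n] curl_flows_subset[OF subset_refl, of n]
      subspace_add[OF subspace_edge_flows[of "all_pairs n"]]
    unfolding gradient_flows_complete curl_flows_complete edge_flows_complete by blast
qed

lemma orthogonal_direct_sum_complete:
  assumes "n \<ge> 1"
  shows "orthogonal_direct_sum (all_pairs n) (H2 n) (H2_1 n) (H2_2 n)"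
proof -
  have orth: "edge_inner (all_pairs n) u w = 0" if "u \<in> H2_1 n" "w \<in> H2_2 n" for u w
    using gradient_orthogonal_curl[OF subset_refl] that
    by (simp add: gradient_flows_complete curl_flows_complete)
  have "u = 0" if "u \<in> H2_1 n" "u \<in> H2_2 n" for u
    using edge_inner_self_eq_0[OF subset_refl] orth[OF that] that
      gradient_flows_subset[OF subset_refl] gradient_flows_complete by blast
  then have "H2_1 n \<inter> H2_2 n = {0}"
    by (auto simp: H2_1_def H2_2_def span_zero)
  then show ?thesis
    using orth H2_eq_sum[OF assms]
    by (simp add: orthogonal_direct_sum_def) (simp add: H2_1_def H2_2_def)
qed

lemma harmonic_flows_complete:
  assumes "n \<ge> 1"
  shows "harmonic_flows (all_pairs n) = {0}"
proof -
  have "X = 0" if "X \<in> harmonic_flows (all_pairs n)" for X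
  proof -
    have X: "X \<in> edge_flows (all_pairs n)"
      and orth: "\<And>u. u \<in> H2_1 n \<Longrightarrow> edge_inner (all_pairs n) X u = 0"
        "\<And>w. w \<in> H2_2 n \<Longrightarrow> edge_inner (all_pairs n) X w = 0"
      using that by (auto simp: harmonic_flows_def gradient_flows_complete curl_flows_complete)
    obtain u w where uw: "X = u + w" "u \<in> H2_1 n" "w \<in> H2_2 n"
      using X H2_eq_sum[OF assms] edge_flows_complete by blast
    have "edge_inner (all_pairs n) X (u + w) = 0"
      using orth uw(2,3) by (simp add: linear_add[OF linear_edge_inner])
    then show ?thesis
      using edge_inner_self_eq_0[OF subset_refl X] uw(1) by simp
  qed
  moreover have "0 \<in> harmonic_flows (all_pairs n)"
    by (simp add: harmonic_flows_def subspace_0[OF subspace_edge_flows] edge_inner_def)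
  ultimately show ?thesis by blast
qed

section \<open>Incomplete graphs\<close>

lemma missing_pair:
  assumes "A \<subset> all_pairs n"
  obtains a b where "a \<in> {1..n}" "b \<in> {1..n}" "a \<noteq> b" "{a, b} \<notin> A"
  using assms unfolding all_pairs_def by blast

lemma edge_flow_missing_pair:
  "X \<in> edge_flows A \<Longrightarrow> {a, b} \<notin> A \<Longrightarrow> Poly_Mapping.lookup X (a, b) = 0"
  by (simp add: edge_flows_def)

lemma lookup_star_flow:
  assumes "{a, b} \<in> all_pairs n"
  shows "Poly_Mapping.lookup (star_flow n a) (a, b) = 1"
  using assms by (subst star_flow_eq_grad) (auto simp: lookup_grad[OF subset_refl])

lemma lookup_triangle_sum:
  assumes "a \<in> {1..n}" "b \<in> {1..n}" "a \<noteq> b"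
  shows "Poly_Mapping.lookup (triangle_sum n a b) (a, b) = real (n - 2)"
proof -
  have "Poly_Mapping.lookup (triangle_sum n a b) (a, b) = (\<Sum>c\<in>{1..n} - {a, b}. 1)"
    unfolding lookup_sum using assms(3)
    by (intro sum.cong) (auto simp: circulation_def lookup_add lookup_x_pref)
  also have "\<dots> = real (n - 2)"
    using assms by (simp add: card_Diff_subset)
  finally show ?thesis .
qed

lemma edge_flows_incomplete:
  assumes "A \<subset> all_pairs n"
  shows "edge_flows A \<noteq> H2 n"
proof -
  obtain a b where ab: "a \<in> {1..n}" "b \<in> {1..n}" "a \<noteq> b" "{a, b} \<notin> A"
    using missing_pair[OF assms] .
  then have "x_pref a b \<in> H2 n"
    unfolding H2_eq_span by (intro span_base) auto
  moreover have "Poly_Mapping.lookup (x_pref a b) (a, b) \<noteq> 0"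
    using ab by (simp add: lookup_x_pref)
  ultimately show ?thesis
    using edge_flow_missing_pair ab(4) by blast
qed

lemma gradient_flows_incomplete:
  assumes "A \<subset> all_pairs n"
  shows "gradient_flows A \<noteq> H2_1 n"
proof -
  obtain a b where ab: "a \<in> {1..n}" "b \<in> {1..n}" "a \<noteq> b" "{a, b} \<notin> A"
    using missing_pair[OF assms] .
  then have "star_flow n a \<in> H2_1 n"
    unfolding H2_1_def by (intro span_base) blast
  moreover have "Poly_Mapping.lookup (star_flow n a) (a, b) \<noteq> 0"
    using lookup_star_flow[of a b n] ab by simp
  ultimately show ?thesis
    using edge_flow_missing_pair ab(4) gradient_flows_subset assms by blast
qed

lemma curl_flows_incomplete:
  assumes "A \<subset> all_pairs n" "n \<ge> 3"
  shows "curl_flows A \<noteq> H2_2 n"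
proof -
  obtain a b where ab: "a \<in> {1..n}" "b \<in> {1..n}" "a \<noteq> b" "{a, b} \<notin> A"
    using missing_pair[OF assms(1)] .
  have "Poly_Mapping.lookup (triangle_sum n a b) (a, b) \<noteq> 0"
    using lookup_triangle_sum[of a n b] ab assms(2) by simp
  then show ?thesis
    using edge_flow_missing_pair ab(4) curl_flows_subset assms(1) triangle_sum_in_H2_2[OF ab(1-3)]
    by blast
qed

text \<open>
  If every vertex were adjacent to all other vertices or to none, one edge would force all the others.
\<close>

lemma mixed_vertex:
  assumes A: "A \<subset> all_pairs n" and "A \<noteq> {}"
  obtains v w u where "{v, w} \<in> A" "u \<in> {1..n}" "u \<noteq> v" "{v, u} \<notin> A"
proof (rule ccontr)
  note witness = that
  assume "\<not> thesis"
  then have all: "{v, u} \<in> A" if "{v, w} \<in> A" "u \<in> {1..n}" "u \<noteq> v" for v w u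
    using witness[OF that] by blast
  obtain p where "p \<in> A" using \<open>A \<noteq> {}\<close> by blast
  moreover from this obtain v w where "p = {v, w}"
    using A unfolding all_pairs_def by blast
  ultimately have vw: "{v, w} \<in> A" by simp
  obtain a b where ab: "a \<in> {1..n}" "b \<in> {1..n}" "a \<noteq> b" "{a, b} \<notin> A"
    using missing_pair[OF A] .
  show False
  proof (cases "a = v")
    case True
    then show False using all[OF vw, of b] ab by simp
  next
    case False
    then have "{a, v} \<in> A" using all[OF vw ab(1)] by (simp add: insert_commute)
    then show False using all[of a v b] ab by simp
  qed
qed

text \<open>
  A gradient flow on the complete graph sums to \<open>0\<close> around every triple of vertices. The gradient
  over \<open>A\<close> of the indicator of a vertex \<open>v\<close> with neighbour \<open>w\<close> and non-neighbour \<open>u\<close> has the sum \<open>1\<close>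
  around \<open>(v, w, u)\<close>: only the edge from \<open>v\<close> to \<open>w\<close> contributes.
\<close>

lemma gradient_flows_incomplete_not_subset:
  assumes A: "A \<subset> all_pairs n" and "A \<noteq> {}"
  shows "\<not> gradient_flows A \<subseteq> H2_1 n"
proof
  assume sub: "gradient_flows A \<subseteq> H2_1 n"
  obtain v w u where vwu: "{v, w} \<in> A" "u \<in> {1..n}" "u \<noteq> v" "{v, u} \<notin> A"
    using mixed_vertex[OF assms] .
  have "w \<noteq> u" using vwu by blast
  have "{v, w} \<in> all_pairs n" using vwu(1) A by blast
  then have tri: "triangle (all_pairs n) v w u"
    using vwu(2,3) \<open>w \<noteq> u\<close> by (simp add: triangle_complete)
  let ?X = "grad A (\<lambda>i. of_bool (i = v))"
  have "?X \<in> gradient_flows A"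
    by (simp add: gradient_flows_def)
  then have "?X \<in> gradient_flows (all_pairs n)"
    using sub gradient_flows_complete by blast
  then have "curl (all_pairs n) ?X v w u = 0"
    by (rule curl_gradient[OF subset_refl])
  moreover have "curl (all_pairs n) ?X v w u = 1"
    using tri vwu \<open>w \<noteq> u\<close> distinct_edge[OF psubset_imp_subset[OF A] vwu(1)]
    by (simp add: curl_def lookup_grad[OF psubset_imp_subset[OF A]] insert_commute)
  ultimately show False by simp
qed

lemma four_cycle:
  assumes "n \<ge> 4"
  obtains A where "A \<subset> all_pairs n" "curl_flows A \<noteq> edge_flows A \<inter> H2_2 n"
    "harmonic_flows A \<noteq> {0}"
proof -
  define A :: "nat set set" where "A = {{1, 2}, {2, 3}, {3, 4}, {4, 1}}"
  define C where "C = x_pref 1 2 + x_pref 2 3 + x_pref 3 4 + x_pref 4 1"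
  have edges: "{1, 2} \<in> A" "{2, 3} \<in> A" "{3, 4} \<in> A" "{4, 1} \<in> A"
    by (simp_all add: A_def)
  have A: "A \<subseteq> all_pairs n"
    using assms by (auto simp: A_def)
  have "{1, 3} \<notin> A" "{1, 3} \<in> all_pairs n"
    using assms by (auto simp: A_def doubleton_eq_iff)
  with A have strict: "A \<subset> all_pairs n" by blast
  \<comment> \<open>The cycle is bipartite, so it has no triangle.\<close>
  have "even i \<noteq> even j" if "{i, j} \<in> A" for i j
    using that by (auto simp: A_def doubleton_eq_iff)
  then have "\<not> triangle A i j k" for i j k
    unfolding triangle_def by metis
  then have curl: "curl_flows A = {0}"
    by (simp add: curl_flows_eq_span[OF A])
  have "C \<in> edge_flows A"
    unfolding C_def by (intro subspace_add[OF subspace_edge_flows] x_pref_edge_flow edges)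
  have "Poly_Mapping.lookup C (1, 2) = 1"
    by (simp add: C_def lookup_add lookup_x_pref)
  then have "C \<noteq> 0" by auto
  \<comment> \<open>The diagonal from 1 to 3 cuts the cycle into two triangles of the complete graph.\<close>
  have "C = circulation 1 2 3 + circulation 1 3 4"
    unfolding C_def circulation_def x_pref_swap[of 1 3] by simp
  also have "\<dots> \<in> H2_2 n"
    unfolding H2_2_def
    by (rule span_add; fold H2_2_def; rule circulation_in_H2_2)
      (use assms in \<open>auto simp: triangle_complete\<close>)
  finally have "C \<in> H2_2 n" .
  have "edge_inner A C Y = 0" if "Y \<in> gradient_flows A" for Y
  proof -
    from that obtain s where Y: "Y = grad A s" by (auto simp: gradient_flows_def)
    have "Y \<in> edge_flows A" using that gradient_flows_subset[OF A] by blast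
    then have "edge_inner A Y C = Poly_Mapping.lookup Y (1, 2) + Poly_Mapping.lookup Y (2, 3)
        + Poly_Mapping.lookup Y (3, 4) + Poly_Mapping.lookup Y (4, 1)"
      unfolding C_def linear_add[OF linear_edge_inner] by (simp only: edge_inner_x_pref[OF A] edges)
    also have "\<dots> = 0"
      unfolding Y by (simp only: lookup_grad[OF A] edges) simp
    finally show ?thesis by (simp add: edge_inner_commute)
  qed
  moreover have "edge_inner A C 0 = 0" by (simp add: edge_inner_def)
  ultimately have "C \<in> harmonic_flows A"
    using \<open>C \<in> edge_flows A\<close> curl by (simp add: harmonic_flows_def)
  show ?thesis
  proof (rule that[OF strict])
    show "curl_flows A \<noteq> edge_flows A \<inter> H2_2 n"
      using curl \<open>C \<in> edge_flows A\<close> \<open>C \<in> H2_2 n\<close> \<open>C \<noteq> 0\<close> by blast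
    show "harmonic_flows A \<noteq> {0}"
      using \<open>C \<in> harmonic_flows A\<close> \<open>C \<noteq> 0\<close> by blast
  qed
qed

section \<open>Comparison with HodgeRank\<close>

theorem proposition42:
  fixes n :: nat
  assumes "n \<ge> 1"
  shows "(edge_flows (all_pairs n) = H2 n \<and>
          gradient_flows (all_pairs n) = H2_1 n \<and>
          curl_flows (all_pairs n) = H2_2 n \<and>
          harmonic_flows (all_pairs n) = {0} \<and>
          orthogonal_direct_sum (all_pairs n) (H2 n) (H2_1 n) (H2_2 n)) \<and>
         (\<forall>A. A \<subset> all_pairs n \<longrightarrow>
            edge_flows A \<noteq> H2 n \<and>
            gradient_flows A \<noteq> H2_1 n \<and>
            (A \<noteq> {} \<longrightarrow> \<not> gradient_flows A \<subseteq> H2_1 n) \<and>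
            (n \<ge> 3 \<longrightarrow> curl_flows A \<noteq> H2_2 n)) \<and>
         (n \<ge> 4 \<longrightarrow> (\<exists>A. A \<subset> all_pairs n \<and>
            curl_flows A \<noteq> edge_flows A \<inter> H2_2 n \<and>
            harmonic_flows A \<noteq> {0}))"
proof (intro conjI allI impI)
  show "\<exists>A. A \<subset> all_pairs n \<and> curl_flows A \<noteq> edge_flows A \<inter> H2_2 n \<and> harmonic_flows A \<noteq> {0}"
    if "n \<ge> 4"
    using four_cycle[OF that] by metis
qed (use assms edge_flows_complete gradient_flows_complete curl_flows_complete
    harmonic_flows_complete orthogonal_direct_sum_complete edge_flows_incomplete
    gradient_flows_incomplete gradient_flows_incomplete_not_subset curl_flows_incomplete
    in \<open>simp_all\<close>)

end
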